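(* Skew normals obtained by the skew-symmetric construction, by the Marshall-Olkin transformation, and by the Order Statistics transformation for $\psi_1>1$ and $\psi_2>1$, are non-infinitely divisible. That is, the distributions on $\mathbb{R}$ with the following densities $s$ are not infinitely divisible: (i) (Skew-symmetric construction) $s(y)=2\phi(y)\pi(y)$, where $\pi$ is a function that satisfies $0\leq\pi(y)\leq 1$ and $\pi(-y)=1-\pi(y)$ for $y\in\mathbb{R}$; (ii) (Marshall-Olkin transformation) $$s(y)=\frac{\gamma\,\phi(y)}{[\Phi(y)+\gamma(1-\Phi(y))]^2},$$ where $\gamma>0$ is a parameter; (iii) (Order Statistics transformation) $$s(y)=[\beta(\psi_1,\psi_2)]^{-1}\phi(y)\,\Phi(y)^{\psi_1-1}(1-\Phi(y))^{\psi_2-1},$$ where $\psi_1>1$ and $\psi_2>1$.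
   Context: $\Phi$ and $\phi$ denote the distribution function and the density function of a standard normal random variable, respectively, and $\beta(\cdot,\cdot)$ denotes the beta function. The "skew normal" obtained by each of the three transformations is the distribution on $\mathbb{R}$ that results from applying the transformation to the standard normal distribution; its density $s$ is the one displayed in the claim. A probability distribution on $\mathbb{R}$ is infinitely divisible if for every integer $n\ge 1$ it is the $n$-fold convolution of some probability distribution on $\mathbb{R}$ with itself.
   Formalization: The cases π = 1/2 almost everywhere in (i) and γ = 1 in (ii) are excluded, since there s is the standard normal density, which is infinitely divisible; π is taken to be Borel measurable so that s is a density. *)

theory Defs
  imports "HOL-Probability.Probability"
begin

text \<open>The empty convolution is the Dirac measure at 0, the neutral element of convolution.\<close>

definition conv_power :: "real measure \<Rightarrow> nat \<Rightarrow> real measure" where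
  "conv_power N n = (convolution N ^^ n) (return borel 0)"

definition infinitely_divisible :: "real measure \<Rightarrow> bool" where
  "infinitely_divisible M \<longleftrightarrow> (\<forall>n\<ge>1. \<exists>N. real_distribution N \<and> M = conv_power N n)"

definition std_normal_cdf :: "real \<Rightarrow> real" where
  "std_normal_cdf = cdf std_normal_distribution"

definition skew_symmetric_density :: "(real \<Rightarrow> real) \<Rightarrow> real \<Rightarrow> real" where
  "skew_symmetric_density \<pi> y = 2 * std_normal_density y * \<pi> y"

definition marshall_olkin_density :: "real \<Rightarrow> real \<Rightarrow> real" where
  "marshall_olkin_density \<gamma> y =
     \<gamma> * std_normal_density y / (std_normal_cdf y + \<gamma> * (1 - std_normal_cdf y))\<^sup>2"

definition order_statistics_density :: "real \<Rightarrow> real \<Rightarrow> real \<Rightarrow> real" where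
  "order_statistics_density \<psi>\<^sub>1 \<psi>\<^sub>2 y =
     inverse (Beta \<psi>\<^sub>1 \<psi>\<^sub>2) * std_normal_density y
       * std_normal_cdf y powr (\<psi>\<^sub>1 - 1) * (1 - std_normal_cdf y) powr (\<psi>\<^sub>2 - 1)"

end

theory Submission
  imports Defs "HOL-Complex_Analysis.Complex_Analysis" "HOL-Real_Asymp.Real_Asymp"
begin

text \<open>
  All three densities are at most \<open>C \<phi>\<close> for some constant \<open>C\<close>, so the moment generating function \<open>M\<close>
  is entire with \<open>|M z| \<le> C exp (|z|\<^sup>2 / 2)\<close>. If the distribution is infinitely divisible, then \<open>M\<close> is
  for every \<open>n\<close> the \<open>n\<close>-th power of an entire function; the order of a zero of \<open>M\<close> would be divisible
  by every \<open>n\<close>, so \<open>M = exp g\<close> with \<open>g\<close> entire. As \<open>Re g\<close> grows at most quadratically, \<open>g\<close> is a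
  polynomial of degree at most 2, and the distribution is normal.

  In the skew-symmetric case, \<open>s y + s (-y) = 2 \<phi> y\<close> forces this normal distribution to be the
  standard one. In the other two cases \<open>ln (s / \<phi>)\<close> would be a quadratic polynomial: for Marshall-Olkin
  it is bounded, hence constant; for order statistics it contains a term \<open>(1 - \<psi>\<^sub>2) ln y\<close> as \<open>y\<close> tends
  to infinity, because \<open>1 - \<Phi> y\<close> is of the order of \<open>\<phi> y / y\<close>.
\<close>

section \<open>Entire functions\<close>

text \<open>The Moebius map \<open>u / (2 A - u)\<close> fixes 0 and sends the half-plane Re u <
  \<open>A\<close> into the unit disc. Schwarz's lemma applies to \<open>f\<close>, rescaled from
  radius \<open>R\<close> to 1 and followed by this map. For |z| at most \<open>R / 2\<close> it
  gives |f z| \<le> |2 A - f z| / 2, which solves to the claim.\<close>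

lemma Borel_Caratheodory_half:
  fixes f :: "complex \<Rightarrow> complex"
  assumes holf: "f holomorphic_on ball 0 R" and f0: "f 0 = 0"
    and Re_less: "\<And>z. norm z < R \<Longrightarrow> Re (f z) < A"
    and z: "norm z \<le> R / 2" and R: "0 < R"
  shows "norm (f z) \<le> 2 * A"
proof -
  have A: "0 < A" using Re_less[of 0] f0 R by simp
  define h where "h = (\<lambda>w. f (of_real R * w) / (2 * of_real A - f (of_real R * w)))"
  have inR: "norm (of_real R * w) < R" if "norm w < 1" for w :: complex
    using that R by (simp add: norm_mult)
  have Rez: "Re (f (of_real R * w)) < A" if "norm w < 1" for w
    using Re_less[OF inR[OF that]] .
  \<comment> \<open>Points with real part below \<open>A\<close> are closer to 0 than to
    \<open>2 A\<close>, the mirror image of 0 in the line Re u = \<open>A\<close>.\<close>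
  have less: "norm u < norm (2 * of_real A - u)" if "Re u < A" for u :: complex
  proof -
    have "(norm u)\<^sup>2 < (norm (2 * of_real A - u))\<^sup>2"
      using mult_strict_left_mono[OF that A]
      unfolding cmod_power2 by (simp add: power2_eq_square algebra_simps)
    then show ?thesis by (simp add: power_less_imp_less_base)
  qed
  have nz: "2 * of_real A - f (of_real R * w) \<noteq> 0" if "norm w < 1" for w
    using less[OF Rez[OF that]] by auto
  have holfR: "(\<lambda>w. f (of_real R * w)) holomorphic_on ball 0 1"
    using holomorphic_on_compose_gen[of "\<lambda>w. of_real R * w" "ball 0 1" f "ball 0 R"] holf inR
    by (simp add: o_def image_subset_iff)
  have "h holomorphic_on ball 0 1"
    unfolding h_def using nz by (intro holomorphic_intros holfR) auto
  moreover have "h 0 = 0" by (simp add: h_def f0)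
  moreover have "norm (h w) < 1" if "norm w < 1" for w
    using less[OF Rez[OF that]] nz[OF that] by (simp add: h_def norm_divide divide_less_eq)
  moreover have zR: "norm (z / of_real R) \<le> 1 / 2"
    using z R by (simp add: norm_divide field_simps)
  ultimately have "norm (h (z / of_real R)) \<le> norm (z / of_real R)"
    by (intro Schwarz_Lemma(1)) auto
  also note zR
  finally have "norm (f z) / norm (2 * of_real A - f z) \<le> 1 / 2"
    using R by (simp add: h_def norm_divide)
  moreover have "0 < norm (2 * of_real A - f z)"
    using nz[of "z / of_real R"] zR R by simp
  ultimately have "2 * norm (f z) \<le> norm (2 * of_real A - f z)"
    by (simp add: field_simps)
  also have "\<dots> \<le> 2 * A + norm (f z)"
    using norm_triangle_ineq4[of "2 * of_real A" "f z"] A by (simp add: norm_mult)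
  finally show ?thesis by simp
qed

text \<open>Borel-Caratheodory on the ball of radius 2|z| turns the one-sided bound on Re f into a
  quadratic bound on |f|; Liouville's theorem for polynomial growth then identifies f with its
  Taylor polynomial of degree 2.\<close>

lemma entire_quadratic_if_Re_le_quadratic:
  fixes f :: "complex \<Rightarrow> complex"
  assumes holf: "f holomorphic_on UNIV" and f0: "f 0 = 0"
    and Re_le: "\<And>z. Re (f z) \<le> A + B * (norm z)\<^sup>2"
  obtains a b where "\<And>z. f z = a * z + b * z\<^sup>2"
proof -
  have "norm (f z) \<le> (2 * (\<bar>A\<bar> + 1) + 8 * \<bar>B\<bar>) * norm z ^ 2" if z: "1 \<le> norm z" for z
  proof -
    \<comment> \<open>The summand 1 makes the bound on Re f strict, as Borel-Caratheodory
      demands.\<close>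
    have "norm (f z) \<le> 2 * (\<bar>A\<bar> + 1 + \<bar>B\<bar> * (2 * norm z)\<^sup>2)"
    proof (rule Borel_Caratheodory_half[where R = "2 * norm z" and f = f and z = z])
      show "f holomorphic_on ball 0 (2 * norm z)" using holf holomorphic_on_subset by blast
      fix w :: complex assume w: "norm w < 2 * norm z"
      have "Re (f w) \<le> A + B * (norm w)\<^sup>2" by (rule Re_le)
      also have "B * (norm w)\<^sup>2 \<le> \<bar>B\<bar> * (2 * norm z)\<^sup>2"
        using w by (intro mult_mono power_mono) auto
      finally show "Re (f w) < \<bar>A\<bar> + 1 + \<bar>B\<bar> * (2 * norm z)\<^sup>2" by linarith
    qed (use f0 z in auto)
    also have "2 * (\<bar>A\<bar> + 1) * 1 \<le> 2 * (\<bar>A\<bar> + 1) * (norm z)\<^sup>2"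
      using z by (intro mult_left_mono) auto
    ultimately show ?thesis by (simp add: algebra_simps)
  qed
  from Liouville_polynomial[OF holf this]
  have *: "f z = (\<Sum>k\<le>2. (deriv ^^ k) f 0 / fact k * z ^ k)" for z .
  show ?thesis
    by (rule that[of "deriv f 0" "(deriv ^^ 2) f 0 / 2"])
       (subst *, simp add: f0 eval_nat_numeral)
qed

text \<open>The point \<open>w\<close> excludes f = 0, so a zero has a finite order n. An entire
  root of degree n + 1 vanishes there too, which would make the order at least n + 1.\<close>

lemma entire_nonzero_if_all_roots:
  fixes f :: "complex \<Rightarrow> complex"
  assumes holf: "f holomorphic_on UNIV" and w: "f w \<noteq> 0"
    and roots: "\<And>n. n \<ge> 1 \<Longrightarrow> \<exists>h. h holomorphic_on UNIV \<and> (\<forall>z. f z = h z ^ n)"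
  shows "f z \<noteq> 0"
proof
  assume fz: "f z = 0"
  have "\<not> f constant_on UNIV" using fz w by (metis UNIV_I constant_on_def)
  then obtain g r n where r: "0 < r" and holg: "g holomorphic_on ball z r"
    and fg: "\<And>w. w \<in> ball z r \<Longrightarrow> f w = (w - z) ^ n * g w"
    and g: "\<And>w. w \<in> ball z r \<Longrightarrow> g w \<noteq> 0"
    using holomorphic_factor_zero_nonconstant[OF holf open_UNIV connected_UNIV UNIV_I fz] by metis
  obtain h where holh: "h holomorphic_on UNIV" and fh: "\<And>w. f w = h w ^ Suc n"
    using roots[of "Suc n"] by auto
  have hz: "h z = 0" using fh[of z] fz by auto
  \<comment> \<open>Off z this is \<open>h w ^ Suc n / (w - z) ^ n\<close>, hence the cofactor
    \<open>g\<close>. Of the n + 1 factors \<open>h\<close>, n become difference quotients with a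
    finite limit, and the last one tends to 0.\<close>
  define q where "q = (\<lambda>w. ((h w - h z) / (w - z)) ^ n * h w)"
  have ev: "\<forall>\<^sub>F w in at z. q w = g w"
    unfolding eventually_at
  proof (intro exI conjI ballI impI)
    fix w assume w: "w \<noteq> z \<and> dist w z < r"
    then have "(w - z) ^ n * g w = h w ^ Suc n"
      using fg[of w] fh[of w] by (simp add: dist_commute)
    then show "q w = g w" using w by (simp add: q_def hz field_simps)
  qed (rule r)
  obtain h' where "(h has_field_derivative h') (at z)"
    using holh by (auto simp: holomorphic_on_def field_differentiable_def)
  then have "((\<lambda>w. (h w - h z) / (w - z)) \<longlongrightarrow> h') (at z)"
    by (simp add: has_field_derivative_iff)
  moreover have "(h \<longlongrightarrow> h z) (at z)"
    using holomorphic_on_imp_continuous_on[OF holh] by (auto simp: continuous_on_def)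
  ultimately have "(q \<longlongrightarrow> h' ^ n * h z) (at z)"
    unfolding q_def by (intro tendsto_intros)
  then have "(g \<longlongrightarrow> 0) (at z)"
    using tendsto_cong[OF ev] hz by simp
  moreover have "(g \<longlongrightarrow> g z) (at z)"
    using holomorphic_on_imp_continuous_on[OF holg] r
    by (metis centre_in_ball continuous_on_eq_continuous_at isCont_def open_ball)
  ultimately have "g z = 0" using LIM_unique by blast
  then show False using g[of z] r by simp
qed

text \<open>The identity theorem, with 0 as limit point of the real line. It lets identities between
  moment generating functions be checked with real integrands only.\<close>

lemma entire_eq_if_eq_on_reals:
  fixes f g :: "complex \<Rightarrow> complex"
  assumes "f holomorphic_on UNIV" "g holomorphic_on UNIV"
    and eq: "\<And>t :: real. f (of_real t) = g (of_real t)"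
  shows "f z = g z"
proof -
  have lim: "(0 :: complex) islimpt range of_real"
    unfolding islimpt_approachable
  proof (intro allI impI)
    fix e :: real assume "0 < e"
    then have "complex_of_real (e / 2) \<noteq> 0" "dist (complex_of_real (e / 2)) 0 < e" by auto
    then show "\<exists>x'\<in>range complex_of_real. x' \<noteq> 0 \<and> dist x' 0 < e" by blast
  qed
  have hol: "(\<lambda>z. f z - g z) holomorphic_on UNIV"
    by (intro holomorphic_intros assms)
  have zero: "f w - g w = 0" if "w \<in> range of_real" for w
    using that eq by (metis imageE right_minus_eq)
  have "f z - g z = 0"
    by (rule analytic_continuation[OF hol open_UNIV connected_UNIV subset_UNIV UNIV_I lim zero UNIV_I])
  then show ?thesis by simp
qed

section \<open>Moment generating functions\<close>

text \<open>The argument is complex so that one function carries the moment generating function on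
  the real axis and the characteristic function on the imaginary axis. If the integrand is not
  integrable, the value is the default 0.\<close>

definition complex_mgf :: "real measure \<Rightarrow> complex \<Rightarrow> complex" where
  "complex_mgf M z = (LINT x|M. exp (z * of_real x))"

lemma char_eq_complex_mgf: "char M t = complex_mgf M (\<i> * of_real t)"
  by (simp only: char_def complex_mgf_def of_real_mult mult.assoc)

lemma complex_mgf_of_real: "complex_mgf M (of_real t) = of_real (LINT x|M. exp (t * x))"
proof -
  have "exp (of_real t * complex_of_real x) = of_real (exp (t * x))" for x
    by (simp only: exp_of_real flip: of_real_mult)
  then show ?thesis by (simp only: complex_mgf_def integral_complex_of_real)
qed

lemma norm_complex_mgf_le: "norm (complex_mgf M z) \<le> (LINT x|M. exp (Re z * x))"
  using integral_norm_bound[of M "\<lambda>x. exp (z * complex_of_real x)"]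
  by (simp add: complex_mgf_def)

lemma sum_power_div_fact_le_exp:
  fixes r :: real
  assumes "0 \<le> r"
  shows "(\<Sum>i<n. r ^ i / fact i) \<le> exp r"
proof -
  have "(\<Sum>i<n. r ^ i / fact i) \<le> (\<Sum>i. r ^ i / fact i)"
    using assms summable_exp[of r] by (intro sum_le_suminf) (auto simp: field_simps)
  then show ?thesis by (simp add: exp_def field_simps)
qed

text \<open>The exponential series is integrated term by term. All partial sums of norms are
  dominated by \<open>exp (norm z * \<bar>x\<bar>)\<close>, which is integrable because it is at
  most the sum of the exponentials with parameters \<open>norm z\<close> and
  \<open>- norm z\<close>. The result is a power series converging everywhere.\<close>

lemma complex_mgf_entire:
  assumes "real_distribution M" and int: "\<And>t. integrable M (\<lambda>x. exp (t * x :: real))"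
  shows "complex_mgf M holomorphic_on UNIV"
proof -
  interpret real_distribution M by fact
  have abs: "integrable M (\<lambda>x. exp (r * \<bar>x\<bar>))" for r
  proof (rule Bochner_Integration.integrable_bound)
    show "integrable M (\<lambda>x. exp (r * x) + exp ((- r) * x))"
      by (intro Bochner_Integration.integrable_add int)
    have "exp (r * \<bar>x\<bar>) \<le> exp (r * x) + exp ((- r) * x)" for x by (auto simp: abs_if)
    then show "AE x in M. norm (exp (r * \<bar>x\<bar>)) \<le> norm (exp (r * x) + exp ((- r) * x))"
      unfolding real_norm_def abs_exp_cancel by (intro AE_I2 order_trans[OF _ abs_ge_self])
  qed auto
  have "(\<lambda>k. (LINT x|M. (complex_of_real x) ^ k) / fact k * (z - 0) ^ k) sums complex_mgf M z" for z
  proof -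
    define f where "f = (\<lambda>k x. (z * complex_of_real x) ^ k / fact k)"
    have norm_f: "norm (f k x) = (norm z * \<bar>x\<bar>) ^ k / fact k" for k x
      by (simp add: f_def norm_divide norm_power norm_mult)
    have partial: "(\<Sum>i<n. norm (f i x)) \<le> exp (norm z * \<bar>x\<bar>)" for n x
      unfolding norm_f by (rule sum_power_div_fact_le_exp) simp
    have int_f: "integrable M (f k)" for k
    proof (rule Bochner_Integration.integrable_bound[OF abs[of "norm z"]])
      show "f k \<in> borel_measurable M" unfolding f_def by measurable
      have "norm (f k x) \<le> exp (norm z * \<bar>x\<bar>)" for x
        by (rule order_trans[OF member_le_sum[where f = "\<lambda>i. norm (f i x)" and i = k] partial[of x "Suc k"]]) auto
      then show "AE x in M. norm (f k x) \<le> norm (exp (norm z * \<bar>x\<bar>))"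
        unfolding real_norm_def abs_exp_cancel by (intro AE_I2)
    qed
    have "(\<lambda>k. integral\<^sup>L M (f k)) sums (LINT x|M. (\<Sum>k. f k x))"
    proof (rule sums_integral[OF int_f])
      show "AE x in M. summable (\<lambda>i. norm (f i x))"
        by (intro AE_I2 summableI_nonneg_bounded[OF _ partial]) simp
      show "summable (\<lambda>i. LINT x|M. norm (f i x))"
      proof (rule summableI_nonneg_bounded)
        fix n
        have "(\<Sum>i<n. LINT x|M. norm (f i x)) = (LINT x|M. (\<Sum>i<n. norm (f i x)))"
          by (rule Bochner_Integration.integral_sum[symmetric]) (intro integrable_norm int_f)
        also have "\<dots> \<le> (LINT x|M. exp (norm z * \<bar>x\<bar>))"
          by (intro integral_mono partial abs Bochner_Integration.integrable_sum integrable_norm int_f)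
        finally show "(\<Sum>i<n. LINT x|M. norm (f i x)) \<le> (LINT x|M. exp (norm z * \<bar>x\<bar>))" .
      qed simp
    qed
    moreover have "(\<Sum>k. f k x) = exp (z * complex_of_real x)" for x
      by (simp add: f_def exp_def scaleR_conv_of_real divide_inverse mult.commute)
    moreover have "integral\<^sup>L M (f k) = (LINT x|M. (complex_of_real x) ^ k) / fact k * (z - 0) ^ k" for k
    proof -
      have "integral\<^sup>L M (f k) = (LINT x|M. (z ^ k / fact k) * (complex_of_real x) ^ k)"
        by (simp add: f_def power_mult_distrib)
      also have "\<dots> = (z ^ k / fact k) * (LINT x|M. (complex_of_real x) ^ k)"
        by (rule integral_mult_right_zero)
      finally show ?thesis by simp
    qed
    ultimately show ?thesis by (simp add: complex_mgf_def)
  qed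
  then have "complex_mgf M holomorphic_on ball 0 r" for r
    by (rule power_series_holomorphic)
  then have "complex_mgf M field_differentiable at z" for z
    using holomorphic_on_imp_differentiable_at[of "complex_mgf M" "ball 0 (norm z + 1)" z] by simp
  then show ?thesis by (simp add: holomorphic_on_def)
qed

section \<open>Moment generating functions of convolution powers\<close>

lemma real_distribution_conv_power:
  assumes "real_distribution N"
  shows "real_distribution (conv_power N n)"
proof (induction n)
  case 0
  interpret prob_space "return borel (0 :: real)" by (rule prob_space_return) simp
  show ?case unfolding conv_power_def by (simp add: real_distribution_def real_distribution_axioms_def prob_space_axioms)
next
  case (Suc n)
  interpret N: real_distribution N by fact
  interpret K: real_distribution "conv_power N n" by fact
  interpret pair_prob_space N "conv_power N n" ..
  have "real_distribution (convolution N (conv_power N n))"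
    unfolding convolution_def by (rule real_distribution_distr) simp
  then show ?case by (simp add: conv_power_def)
qed

text \<open>The nonnegative integral makes multiplicativity valid in [0, \<infinity>] before
  anything is known about integrability under \<open>N\<close>.\<close>

lemma nn_integral_exp_conv_power:
  assumes "real_distribution N"
  shows "(\<integral>\<^sup>+x. ennreal (exp (t * x)) \<partial>conv_power N n) = (\<integral>\<^sup>+x. ennreal (exp (t * x)) \<partial>N) ^ n"
proof (induction n)
  case 0
  show ?case by (simp add: conv_power_def nn_integral_return)
next
  case (Suc n)
  interpret N: real_distribution N by fact
  interpret K: real_distribution "conv_power N n" by (rule real_distribution_conv_power) fact
  have "(\<integral>\<^sup>+x. ennreal (exp (t * x)) \<partial>convolution N (conv_power N n)) =
      (\<integral>\<^sup>+x. \<integral>\<^sup>+y. ennreal (exp (t * (x + y))) \<partial>conv_power N n \<partial>N)"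
    by (rule nn_integral_convolution) auto
  also have "\<dots> = (\<integral>\<^sup>+x. ennreal (exp (t * x)) * (\<integral>\<^sup>+y. ennreal (exp (t * y)) \<partial>conv_power N n) \<partial>N)"
    by (simp add: distrib_left exp_add ennreal_mult nn_integral_cmult)
  also have "\<dots> = (\<integral>\<^sup>+x. ennreal (exp (t * x)) \<partial>N) * (\<integral>\<^sup>+y. ennreal (exp (t * y)) \<partial>conv_power N n)"
    by (simp add: nn_integral_multc)
  finally show ?case using Suc by (simp add: conv_power_def)
qed

text \<open>A finite n-th power with n \<ge> 1 forces a finite base, so the factor inherits all
  exponential moments. Both sides of the product formula are then entire, and agreement on the reals
  suffices.\<close>

lemma complex_mgf_conv_power:
  assumes N: "real_distribution N" and n: "n \<ge> 1"
    and int: "\<And>t. integrable (conv_power N n) (\<lambda>x. exp (t * x :: real))"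
  shows "\<And>t. integrable N (\<lambda>x. exp (t * x :: real))"
    and "complex_mgf (conv_power N n) z = complex_mgf N z ^ n"
proof -
  interpret N: real_distribution N by fact
  note K = real_distribution_conv_power[OF N, of n]
  show intN: "integrable N (\<lambda>x. exp (t * x))" for t :: real
  proof (rule integrableI_nonneg)
    have "(\<integral>\<^sup>+x. ennreal (exp (t * x)) \<partial>N) ^ n < \<infinity>"
      using int[of t] by (simp add: integrable_iff_bounded flip: nn_integral_exp_conv_power[OF N])
    then show "(\<integral>\<^sup>+x. ennreal (exp (t * x)) \<partial>N) < \<infinity>"
      using n by (simp add: power_less_top_ennreal)
  qed auto
  have real: "complex_mgf (conv_power N n) (of_real t) = complex_mgf N (of_real t) ^ n" for t
  proof -
    have "ennreal (LINT x|conv_power N n. exp (t * x)) = ennreal ((LINT x|N. exp (t * x)) ^ n)"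
      using nn_integral_exp_conv_power[OF N, where t = t and n = n]
      by (simp add: nn_integral_eq_integral int intN ennreal_power)
    then have "(LINT x|conv_power N n. exp (t * x)) = (LINT x|N. exp (t * x)) ^ n"
      by (simp add: integral_nonneg_AE)
    then show ?thesis
      by (simp add: complex_mgf_of_real)
  qed
  show "complex_mgf (conv_power N n) z = complex_mgf N z ^ n"
    by (rule entire_eq_if_eq_on_reals[OF complex_mgf_entire[OF K int] _ real])
       (intro holomorphic_intros complex_mgf_entire[OF N intN])
qed

section \<open>Infinitely divisible laws with Gaussian tails\<close>

text \<open>Here the function theory meets probability. The case c = 0, a point mass, is still
  allowed; it is excluded later by the existence of a density.\<close>

lemma infinitely_divisible_char_gaussian:
  assumes M: "real_distribution M" and idiv: "infinitely_divisible M"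
    and bound: "\<And>t. (\<integral>\<^sup>+x. ennreal (exp (t * x)) \<partial>M) \<le> ennreal (C * exp (t\<^sup>2 / 2))"
  obtains b c :: real where "0 \<le> c"
    and "\<And>t. char M t = exp (of_real (- (c * t\<^sup>2)) + \<i> * of_real (b * t))"
proof -
  interpret real_distribution M by fact
  have int: "integrable M (\<lambda>x. exp (t * x))" for t :: real
    using le_less_trans[OF bound[of t]] by (intro integrableI_nonneg) auto
  have pos: "0 < (LINT x|M. exp (t * x))" for t :: real
    using integral_less_AE_space[of "\<lambda>x. 0" "\<lambda>x. exp (t * x)"] int[of t] emeasure_space_1
    by simp
  have mgf_le: "(LINT x|M. exp (t * x)) \<le> C * exp (t\<^sup>2 / 2)" for t :: real
  proof -
    have "ennreal (LINT x|M. exp (t * x)) \<le> ennreal (C * exp (t\<^sup>2 / 2))"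
      using bound[of t] by (simp add: nn_integral_eq_integral int)
    then show ?thesis using pos[of t] by (auto simp: ennreal_le_iff2)
  qed
  have mgf0: "complex_mgf M 0 = 1"
    using prob_space by (simp add: complex_mgf_def)
  \<comment> \<open>At t = 0 the integral is the total mass 1. Hence \<open>ln C\<close> below is a
    genuine logarithm.\<close>
  have C: "1 \<le> C"
    using mgf_le[of 0] prob_space by simp
  note hol = complex_mgf_entire[OF M int]
  have "complex_mgf M z \<noteq> 0" for z
  proof (rule entire_nonzero_if_all_roots[OF hol])
    show "complex_mgf M 0 \<noteq> 0" by (simp add: mgf0)
    fix n :: nat assume n: "n \<ge> 1"
    with idiv obtain N where N: "real_distribution N" "M = conv_power N n"
      by (auto simp: infinitely_divisible_def)
    note intN = complex_mgf_conv_power(1)[OF N(1) n int[unfolded N(2)]]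
    show "\<exists>h. h holomorphic_on UNIV \<and> (\<forall>z. complex_mgf M z = h z ^ n)"
      using complex_mgf_entire[OF N(1) intN] complex_mgf_conv_power(2)[OF N(1) n int[unfolded N(2)]]
      by (auto simp: N(2))
  qed
  then obtain g where g: "g holomorphic_on UNIV" and exp_g: "\<And>z. exp (g z) = complex_mgf M z"
    using holomorphic_logarithm_exists[OF convex_UNIV open_UNIV hol, of 0] by auto
  \<comment> \<open>Since M 0 = 1, also \<open>exp (g 0) = 1\<close>; subtracting \<open>g 0\<close>
    gives a logarithm of M that vanishes at 0.\<close>
  have exp_diff: "exp (g z - g 0) = complex_mgf M z" for z
    by (simp add: exp_diff exp_g mgf0)
  obtain a b where ab: "\<And>z. g z - g 0 = a * z + b * z\<^sup>2"
  proof (rule entire_quadratic_if_Re_le_quadratic)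
    show "(\<lambda>z. g z - g 0) holomorphic_on UNIV" by (intro holomorphic_intros g)
    fix z
    have "exp (Re (g z - g 0)) = norm (complex_mgf M z)"
      by (simp flip: exp_diff)
    also have "\<dots> \<le> C * exp ((Re z)\<^sup>2 / 2)"
      using norm_complex_mgf_le mgf_le by (rule order_trans)
    also have "\<dots> \<le> C * exp ((norm z)\<^sup>2 / 2)"
      using C by (simp add: cmod_power2)
    also have "\<dots> = exp (ln C + 1 / 2 * (norm z)\<^sup>2)"
      using C by (simp add: exp_add)
    finally show "Re (g z - g 0) \<le> ln C + 1 / 2 * (norm z)\<^sup>2" by simp
  qed (simp, blast)
  \<comment> \<open>On the real axis M is positive and so equals its modulus, which involves only
    the real parts of \<open>a\<close> and \<open>b\<close>. The identity theorem extends the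
    formula with these real coefficients to the plane.\<close>
  have mgf: "complex_mgf M z = exp (of_real (Re a) * z + of_real (Re b) * z\<^sup>2)" for z
  proof (rule entire_eq_if_eq_on_reals[OF hol])
    show "(\<lambda>z. exp (of_real (Re a) * z + of_real (Re b) * z\<^sup>2)) holomorphic_on UNIV"
      by (intro holomorphic_intros)
    fix t :: real
    have "complex_mgf M (of_real t) = of_real (norm (complex_mgf M (of_real t)))"
      using pos[of t] by (simp add: complex_mgf_of_real)
    also have "norm (complex_mgf M (of_real t)) = exp (Re (a * of_real t + b * (of_real t)\<^sup>2))"
      by (simp flip: exp_diff ab)
    finally show "complex_mgf M (of_real t) =
        exp (of_real (Re a) * of_real t + of_real (Re b) * (of_real t)\<^sup>2)"
      by (simp add: exp_of_real flip: of_real_mult of_real_power of_real_add)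
  qed
  have char: "char M t = exp (of_real (- (Re b * t\<^sup>2)) + \<i> * of_real (Re a * t))" for t
    by (simp add: char_eq_complex_mgf mgf power_mult_distrib mult_ac)
  \<comment> \<open>A characteristic function has modulus at most 1; its value at 1 gives the sign
    of \<open>Re b\<close>.\<close>
  have "exp (- Re b) \<le> 1"
    using cmod_char_le_1[of 1] by (simp add: char)
  then show ?thesis
    using char by (intro that[of "Re b" "Re a"]) auto
qed

lemma char_normal_density:
  assumes "0 < \<sigma>"
  shows "char (density lborel (normal_density \<mu> \<sigma>)) t = exp (of_real (- (\<sigma>\<^sup>2 / 2 * t\<^sup>2)) + \<i> * of_real (\<mu> * t))"
proof -
  interpret real_distribution std_normal_distribution by (rule real_dist_normal_dist)
  \<comment> \<open>The identity is treated as a standard normal variable, whose affine image has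
    mean \<open>\<mu>\<close> and deviation \<open>\<sigma>\<close>.\<close>
  have "distributed std_normal_distribution lborel (\<lambda>x. x) std_normal_density"
    unfolding distributed_def by (auto simp: distr_id2)
  from normal_density_affine[OF this, of \<sigma> \<mu>] assms
  have "distr std_normal_distribution lborel (\<lambda>x. \<mu> + \<sigma> * x) = density lborel (normal_density \<mu> \<sigma>)"
    by (simp add: distributed_def)
  then have "char (density lborel (normal_density \<mu> \<sigma>)) t =
      (LINT x|std_normal_distribution. iexp (t * (\<mu> + \<sigma> * x)))"
    by (simp add: char_def integral_distr flip: \<open>distr _ _ _ = _\<close>)
  also have "\<dots> = (LINT x|std_normal_distribution. iexp (t * \<mu>) * iexp ((t * \<sigma>) * x))"
    by (simp add: distrib_left exp_add mult_ac)
  also have "\<dots> = iexp (t * \<mu>) * char std_normal_distribution (t * \<sigma>)"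
    unfolding char_def by (rule integral_mult_right_zero)
  also have "\<dots> = exp (of_real (- (\<sigma>\<^sup>2 / 2 * t\<^sup>2)) + \<i> * of_real (\<mu> * t))"
    unfolding char_std_normal_distribution by (simp add: algebra_simps flip: exp_add exp_of_real)
  finally show ?thesis .
qed

text \<open>Completing the square: tilting the standard normal density by \<open>exp (t * x)\<close>
  shifts its mean to t and leaves the factor \<open>exp (t\<^sup>2 / 2)\<close>.\<close>

lemma nn_integral_exp_std_normal: "(\<integral>\<^sup>+x. ennreal (std_normal_density x * exp (t * x)) \<partial>lborel) = ennreal (exp (t\<^sup>2 / 2))"
proof -
  have "std_normal_density x * exp (t * x) = exp (t\<^sup>2 / 2) * normal_density t 1 x" for x
    by (simp add: normal_density_def power2_eq_square field_simps flip: exp_add)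
  then have "(\<integral>\<^sup>+x. ennreal (std_normal_density x * exp (t * x)) \<partial>lborel) =
      ennreal (exp (t\<^sup>2 / 2)) * (\<integral>\<^sup>+x. ennreal (normal_density t 1 x) \<partial>lborel)"
    by (simp add: ennreal_mult nn_integral_cmult)
  then show ?thesis by (simp add: nn_integral_eq_integral)
qed

lemma infinitely_divisible_density_normal:
  assumes f[measurable]: "f \<in> borel_measurable borel"
    and le: "\<And>x. f x \<le> C * std_normal_density x"
    and idiv: "infinitely_divisible (density lborel f)"
  obtains \<mu> \<sigma> where "0 < \<sigma>" and "density lborel f = density lborel (normal_density \<mu> \<sigma>)"
proof -
  let ?M = "density lborel f"
  \<comment> \<open>Divisibility with n = 1 shows that the measure is a probability
    distribution.\<close>
  from idiv obtain N where "real_distribution N" "?M = conv_power N 1"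
    by (auto simp: infinitely_divisible_def)
  then have M: "real_distribution ?M" by (simp add: real_distribution_conv_power)
  have "(\<integral>\<^sup>+x. ennreal (exp (t * x)) \<partial>?M) \<le> ennreal (max C 0 * exp (t\<^sup>2 / 2))" for t
  proof -
    have "(\<integral>\<^sup>+x. ennreal (exp (t * x)) \<partial>?M) = (\<integral>\<^sup>+x. ennreal (f x) * ennreal (exp (t * x)) \<partial>lborel)"
      by (rule nn_integral_density) auto
    also have "\<dots> \<le> (\<integral>\<^sup>+x. ennreal (max C 0) * ennreal (std_normal_density x * exp (t * x)) \<partial>lborel)"
    proof (rule nn_integral_mono)
      fix x
      \<comment> \<open>The constant \<open>max C 0\<close> is nonnegative, so that
        \<open>ennreal\<close> respects the products.\<close>
      have "f x * exp (t * x) \<le> max C 0 * std_normal_density x * exp (t * x)"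
        by (intro mult_right_mono order_trans[OF le]) auto
      from ennreal_leI[OF this]
      show "ennreal (f x) * ennreal (exp (t * x)) \<le> ennreal (max C 0) * ennreal (std_normal_density x * exp (t * x))"
        by (simp only: ennreal_mult''[OF exp_ge_zero, symmetric] mult.assoc
            ennreal_mult''[OF mult_nonneg_nonneg[OF normal_density_nonneg exp_ge_zero], symmetric])
    qed
    also have "\<dots> = ennreal (max C 0) * ennreal (exp (t\<^sup>2 / 2))"
      unfolding nn_integral_exp_std_normal[symmetric] by (rule nn_integral_cmult) simp
    also have "\<dots> = ennreal (max C 0 * exp (t\<^sup>2 / 2))"
      by (rule ennreal_mult''[symmetric]) simp
    finally show ?thesis .
  qed
  from infinitely_divisible_char_gaussian[OF M idiv this]
  obtain b c where c: "0 \<le> c" and char: "\<And>t. char ?M t = exp (of_real (- (c * t\<^sup>2)) + \<i> * of_real (b * t))"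
    by blast
  show ?thesis
  proof (cases "c = 0")
    \<comment> \<open>The law would be a point mass at \<open>b\<close>, but a law with a density
      gives no mass to a point.\<close>
    case True
    interpret R: prob_space "return borel b" by (rule prob_space_return) simp
    have "real_distribution (return borel b)"
      by (simp add: real_distribution_def real_distribution_axioms_def R.prob_space_axioms)
    moreover have "char ?M = char (return borel b)"
      by (rule ext) (simp add: char True, simp add: char_def integral_return mult_ac)
    ultimately have "?M = return borel b" using Levy_uniqueness[OF M] by blast
    then have "emeasure ?M {b} = 1" by simp
    moreover have "emeasure ?M {b} = (\<integral>\<^sup>+x. ennreal (f x) * indicator {b} x \<partial>lborel)"
      by (rule emeasure_density) auto
    ultimately show ?thesis by simp
  next
    case False
    \<comment> \<open>The exponent of a normal law has \<open>\<sigma>\<^sup>2 / 2\<close> in the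
      place of c, whence the deviation \<open>sqrt (2 * c)\<close>.\<close>
    interpret P: prob_space "density lborel (normal_density b (sqrt (2 * c)))"
      using c False by (intro prob_space_normal_density) simp
    have "real_distribution (density lborel (normal_density b (sqrt (2 * c))))"
      by (simp add: real_distribution_def real_distribution_axioms_def P.prob_space_axioms)
    moreover have "char ?M = char (density lborel (normal_density b (sqrt (2 * c))))"
      using c False by (intro ext) (simp add: char char_normal_density)
    ultimately have "?M = density lborel (normal_density b (sqrt (2 * c)))"
      using Levy_uniqueness[OF M] by blast
    then show ?thesis using c False by (intro that[of "sqrt (2 * c)" b]) auto
  qed
qed

section \<open>The standard normal distribution\<close>

lemma continuous_on_normal_density: "0 < \<sigma> \<Longrightarrow> continuous_on S (normal_density \<mu> \<sigma>)"
  unfolding normal_density_def by (intro continuous_intros) auto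

lemmas continuous_on_std_normal_density = continuous_on_normal_density[OF zero_less_one, of _ 0]

lemma std_normal_density_pos: "0 < std_normal_density y"
  by (rule normal_density_pos) simp

lemma std_normal_density_has_field_derivative:
  "(std_normal_density has_field_derivative - x * std_normal_density x) (at x)"
proof -
  have "((\<lambda>x. k * exp (- x\<^sup>2 / 2)) has_field_derivative - x * (k * exp (- x\<^sup>2 / 2))) (at x)" for k :: real
    by (auto intro!: derivative_eq_intros)
  then show ?thesis unfolding std_normal_density_def .
qed

lemma std_normal_cdf_has_field_derivative:
  "(std_normal_cdf has_field_derivative std_normal_density x) (at x)"
proof -
  interpret real_distribution std_normal_distribution by (rule real_dist_normal_dist)
  \<comment> \<open>Any base point left of x would do: up to a constant, the distribution function
    is an integral over a compact interval, and the fundamental theorem of calculus applies at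
    x.\<close>
  define a where "a = x - 1"
  have cdf: "std_normal_cdf u = std_normal_cdf a + integral {a..u} std_normal_density" if "a < u" for u
  proof -
    have "std_normal_cdf u - std_normal_cdf a = measure std_normal_distribution {a<..u}"
      unfolding std_normal_cdf_def using that by (rule cdf_diff_eq)
    also have "\<dots> = (LINT t|std_normal_distribution. indicator {a<..u} t)" by simp
    also have "\<dots> = (LINT t|lborel. std_normal_density t *\<^sub>R indicator {a<..u} t)"
      by (rule integral_density) auto
    also have "\<dots> = (LINT t:{a..u}|lborel. std_normal_density t)"
      unfolding set_lebesgue_integral_def
      by (rule integral_cong_AE) (use AE_lborel_singleton[of a] in \<open>auto split: split_indicator\<close>)
    also have "\<dots> = integral {a..u} std_normal_density"
      by (rule set_borel_integral_eq_integral)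
         (unfold set_integrable_def, intro integrable_mult_indicator, auto)
    finally show ?thesis by simp
  qed
  have "((\<lambda>u. integral {a..u} std_normal_density) has_real_derivative std_normal_density x) (at x within {a..x + 1})"
    by (rule integral_has_real_derivative[OF continuous_on_std_normal_density]) (simp add: a_def)
  then have "((\<lambda>u. std_normal_cdf a + integral {a..u} std_normal_density) has_real_derivative std_normal_density x) (at x)"
    using DERIV_add[OF DERIV_const] by (fastforce simp: a_def at_within_Icc_at)
  then show ?thesis
    by (rule has_field_derivative_transform_within_open[where S = "{a<..}"]) (auto simp: a_def cdf)
qed

lemma continuous_on_std_normal_cdf: "continuous_on S std_normal_cdf"
  by (intro continuous_at_imp_continuous_on ballI DERIV_isCont[OF std_normal_cdf_has_field_derivative])

lemma std_normal_cdf_strict_mono: "x < y \<Longrightarrow> std_normal_cdf x < std_normal_cdf y"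
  by (rule DERIV_pos_imp_increasing) (blast intro: std_normal_cdf_has_field_derivative std_normal_density_pos)+

lemma std_normal_cdf_pos: "0 < std_normal_cdf x"
proof -
  interpret real_distribution std_normal_distribution by (rule real_dist_normal_dist)
  have "0 \<le> std_normal_cdf (x - 1)" by (simp add: std_normal_cdf_def cdf_nonneg)
  also have "\<dots> < std_normal_cdf x" by (simp add: std_normal_cdf_strict_mono)
  finally show ?thesis .
qed

lemma std_normal_cdf_less_1: "std_normal_cdf x < 1"
proof -
  interpret real_distribution std_normal_distribution by (rule real_dist_normal_dist)
  have "std_normal_cdf x < std_normal_cdf (x + 1)" by (simp add: std_normal_cdf_strict_mono)
  also have "\<dots> \<le> 1" by (simp add: std_normal_cdf_def cdf_bounded_prob)
  finally show ?thesis .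
qed

section \<open>Bounds of Mills type for the normal tail\<close>

lemma std_normal_density_over_id_has_field_derivative:
  assumes "0 < y"
  shows "((\<lambda>y. std_normal_density y / y) has_field_derivative - std_normal_density y * (1 + 1 / y\<^sup>2)) (at y)"
  using assms
  by (auto intro!: derivative_eq_intros std_normal_density_has_field_derivative simp: field_simps power2_eq_square)

lemma std_normal_density_over_id_tendsto: "((\<lambda>y. std_normal_density y / y) \<longlongrightarrow> 0) at_top"
  unfolding std_normal_density_def by real_asymp

lemma std_normal_cdf_tendsto: "(std_normal_cdf \<longlongrightarrow> 1) at_top"
  unfolding std_normal_cdf_def
  by (rule real_distribution.cdf_lim_at_top_prob[OF real_dist_normal_dist])

text \<open>The difference of the two sides tends to 0 at infinity and has derivative
  \<open>- std_normal_density x / x\<^sup>2\<close>, so it decreases to 0 and is positive.\<close>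

lemma std_normal_tail_upper:
  assumes "0 < y"
  shows "1 - std_normal_cdf y < std_normal_density y / y"
proof -
  have "0 < std_normal_density y / y - (1 - std_normal_cdf y)"
  proof (rule DERIV_neg_imp_decreasing_at_top[where f = "\<lambda>y. std_normal_density y / y - (1 - std_normal_cdf y)"])
    fix x assume x: "x \<ge> y"
    have "((\<lambda>y. std_normal_density y / y - (1 - std_normal_cdf y)) has_field_derivative
        - std_normal_density x * (1 + 1 / x\<^sup>2) - (0 - std_normal_density x)) (at x)"
      using x assms by (intro DERIV_diff DERIV_const std_normal_density_over_id_has_field_derivative
          std_normal_cdf_has_field_derivative) auto
    moreover have "- std_normal_density x * (1 + 1 / x\<^sup>2) - (0 - std_normal_density x) < 0"
      using x assms normal_density_pos[of 1 0 x] by (simp add: algebra_simps)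
    ultimately show "\<exists>d. ((\<lambda>y. std_normal_density y / y - (1 - std_normal_cdf y)) has_real_derivative d) (at x) \<and> d < 0"
      by blast
  next
    show "((\<lambda>y. std_normal_density y / y - (1 - std_normal_cdf y)) \<longlongrightarrow> 0) at_top"
      using tendsto_diff[OF std_normal_density_over_id_tendsto tendsto_diff[OF tendsto_const std_normal_cdf_tendsto, of 1]]
      by simp
  qed
  then show ?thesis by simp
qed

text \<open>The same argument: the derivative is now
  \<open>std_normal_density x * (1 / x\<^sup>2 - 1)\<close>, negative for x > 1. The factor 2 is
  crude, but after taking logarithms it costs only the constant \<open>ln 2\<close>.\<close>

lemma std_normal_tail_lower:
  assumes "1 < y"
  shows "std_normal_density y / y < 2 * (1 - std_normal_cdf y)"
proof -
  have "0 < 2 * (1 - std_normal_cdf y) - std_normal_density y / y"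
  proof (rule DERIV_neg_imp_decreasing_at_top[where f = "\<lambda>y. 2 * (1 - std_normal_cdf y) - std_normal_density y / y"])
    fix x assume x: "x \<ge> y"
    have "((\<lambda>y. 2 * (1 - std_normal_cdf y) - std_normal_density y / y) has_field_derivative
        2 * (0 - std_normal_density x) - (- std_normal_density x * (1 + 1 / x\<^sup>2))) (at x)"
      using x assms by (intro DERIV_diff DERIV_cmult DERIV_const std_normal_density_over_id_has_field_derivative
          std_normal_cdf_has_field_derivative) auto
    moreover have "2 * (0 - std_normal_density x) - (- std_normal_density x * (1 + 1 / x\<^sup>2)) < 0"
    proof -
      have "1 < x\<^sup>2" using x assms by (intro one_less_power) auto
      then have "1 / x\<^sup>2 < 1" by (subst divide_less_eq_1_pos) linarith+
      then have "std_normal_density x * (1 / x\<^sup>2) < std_normal_density x * 1"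
        using std_normal_density_pos[of x] by (rule mult_strict_left_mono)
      then show ?thesis by (simp add: algebra_simps)
    qed
    ultimately show "\<exists>d. ((\<lambda>y. 2 * (1 - std_normal_cdf y) - std_normal_density y / y) has_real_derivative d) (at x) \<and> d < 0"
      by blast
  next
    show "((\<lambda>y. 2 * (1 - std_normal_cdf y) - std_normal_density y / y) \<longlongrightarrow> 0) at_top"
      using tendsto_diff[OF tendsto_mult[OF tendsto_const[of 2] tendsto_diff[OF tendsto_const std_normal_cdf_tendsto, of 1]]
        std_normal_density_over_id_tendsto]
      by simp
  qed
  then show ?thesis by simp
qed

section \<open>The skew normal densities\<close>

text \<open>The assumption \<open>not_AE\<close> excludes the normal law itself, which is infinitely
  divisible. Only measurability of \<open>p\<close> is available, so the normal parameters are found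
  from characteristic functions instead of tail asymptotics.\<close>

lemma not_infinitely_divisible_skew_symmetric:
  fixes p :: "real \<Rightarrow> real"
  assumes p[measurable]: "p \<in> borel_measurable borel"
    and p01: "\<And>y. 0 \<le> p y" "\<And>y. p y \<le> 1"
    and p_uminus: "\<And>y. p (- y) = 1 - p y"
    and not_AE: "\<not> (AE y in lborel. p y = 1 / 2)"
  shows "\<not> infinitely_divisible (density lborel (skew_symmetric_density p))"
proof
  let ?s = "skew_symmetric_density p"
  assume idiv: "infinitely_divisible (density lborel ?s)"
  have s[measurable]: "?s \<in> borel_measurable borel"
    unfolding skew_symmetric_density_def by measurable
  have s_nonneg: "0 \<le> ?s y" for y by (simp add: skew_symmetric_density_def p01)
  have s_le: "?s y \<le> 2 * std_normal_density y" for y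
    using mult_left_mono[OF p01(2), of "2 * std_normal_density y" y] by (simp add: skew_symmetric_density_def)
  have s_sym: "?s y + ?s (- y) = 2 * std_normal_density y" for y
  proof -
    have "std_normal_density (- y) = std_normal_density y" by (simp add: std_normal_density_def)
    then show ?thesis by (simp add: skew_symmetric_density_def p_uminus algebra_simps)
  qed
  obtain \<mu> \<sigma> where \<sigma>: "0 < \<sigma>" and eq: "density lborel ?s = density lborel (normal_density \<mu> \<sigma>)"
    using infinitely_divisible_density_normal[OF s s_le idiv] by blast
  have char_s: "char (density lborel ?s) t = (LINT x|lborel. ?s x *\<^sub>R iexp (t * x))" for t
    unfolding char_def by (intro integral_density) (auto simp: s_nonneg)
  have int_s: "integrable lborel ?s"
    by (rule Bochner_Integration.integrable_bound[of _ "\<lambda>x. 2 * std_normal_density x"])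
       (use s_le s_nonneg in auto)
  have int_iexp: "integrable lborel (\<lambda>x. ?s (c * x) *\<^sub>R iexp (t * x))" if "c \<noteq> 0" for c t
    by (rule Bochner_Integration.integrable_bound[OF lborel_integrable_real_affine[OF int_s that, of 0]])
       (auto simp: s_nonneg)
  \<comment> \<open>Adding the characteristic function at t and at -t symmetrises the density, which
    leaves twice the standard normal one; the real part of the candidate normal law gives the
    cosine.\<close>
  have sym: "cos (\<mu> * t) * exp (- (\<sigma>\<^sup>2 / 2 * t\<^sup>2)) = exp (- t\<^sup>2 / 2)" for t
  proof -
    have "char (density lborel ?s) (- t) = (LINT x|lborel. ?s (- x) *\<^sub>R iexp (t * x))"
      unfolding char_s by (subst lborel_integral_real_affine[where c = "- 1" and t = 0]) auto
    then have "char (density lborel ?s) t + char (density lborel ?s) (- t) =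
        (LINT x|lborel. ?s x *\<^sub>R iexp (t * x) + ?s (- x) *\<^sub>R iexp (t * x))"
      unfolding char_s using int_iexp[of 1 t] int_iexp[of "- 1" t]
      by (subst Bochner_Integration.integral_add) auto
    also have "\<dots> = (LINT x|lborel. 2 *\<^sub>R (std_normal_density x *\<^sub>R iexp (t * x)))"
      by (simp add: s_sym flip: scaleR_left_distrib)
    also have "\<dots> = 2 *\<^sub>R (LINT x|lborel. std_normal_density x *\<^sub>R iexp (t * x))"
      by (rule integral_scaleR_right)
    also have "(LINT x|lborel. std_normal_density x *\<^sub>R iexp (t * x)) = char std_normal_distribution t"
      unfolding char_def by (subst integral_density) auto
    finally have "Re (char (density lborel ?s) t + char (density lborel ?s) (- t)) = 2 * exp (- t\<^sup>2 / 2)"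
      unfolding char_std_normal_distribution by simp
    then show ?thesis unfolding eq char_normal_density[OF \<sigma>] by (simp add: Re_exp)
  qed
  have "\<mu> = 0"
  proof (rule ccontr)
    assume "\<mu> \<noteq> 0"
    \<comment> \<open>At this t the cosine vanishes, while the right-hand side is positive.\<close>
    then show False using sym[of "pi / 2 / \<mu>"] by simp
  qed
  moreover have "\<sigma> = 1"
    using sym[of 1] \<open>\<mu> = 0\<close> \<sigma> by (simp add: power2_eq_1_iff)
  ultimately have "AE y in lborel. ennreal (?s y) = ennreal (std_normal_density y)"
    using eq by (intro sigma_finite_measure.density_unique[OF sigma_finite_lborel]) auto
  then have "AE y in lborel. p y = 1 / 2"
  proof eventually_elim
    case (elim y)
    then have "?s y = std_normal_density y" by (simp add: s_nonneg)
    moreover have "0 < std_normal_density y" by (rule normal_density_pos) simp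
    ultimately show ?case by (simp add: skew_symmetric_density_def)
  qed
  with not_AE show False by contradiction
qed

section \<open>Growth of a quadratic polynomial plus a logarithm\<close>

lemma bounded_over_at_top_limit_eq_0:
  fixes f g :: "real \<Rightarrow> real"
  assumes bounded: "\<forall>\<^sub>F y in at_top. \<bar>f y\<bar> \<le> B" and g: "filterlim g at_top at_top"
    and lim: "((\<lambda>y. f y / g y) \<longlongrightarrow> L) at_top"
  shows "L = 0"
proof -
  have "((\<lambda>y. f y / g y) \<longlongrightarrow> 0) at_top"
  proof (rule Lim_null_comparison)
    show "\<forall>\<^sub>F y in at_top. norm (f y / g y) \<le> B / g y"
      using bounded filterlim_at_top_dense[THEN iffD1, OF g, rule_format, of 0]
      by eventually_elim (simp add: divide_right_mono)
    show "((\<lambda>y. B / g y) \<longlongrightarrow> 0) at_top"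
      by (rule real_tendsto_divide_at_top[OF tendsto_const g])
  qed
  with lim show ?thesis by (rule tendsto_unique[rotated]) simp
qed

text \<open>Dividing by \<open>y\<^sup>2\<close>, y and \<open>ln y\<close> in turn, the fastest
  scale first, isolates one coefficient at a time; those already known to vanish drop out of the
  next quotient.\<close>

lemma bounded_quadratic_plus_ln:
  fixes a b c d :: real
  assumes bounded: "\<forall>\<^sub>F y in at_top. \<bar>a * y\<^sup>2 + b * y + c + d * ln y\<bar> \<le> B"
  shows "a = 0" and "b = 0" and "d = 0"
proof -
  show a: "a = 0"
  proof (rule bounded_over_at_top_limit_eq_0[OF bounded])
    show "filterlim (\<lambda>y :: real. y\<^sup>2) at_top at_top" by real_asymp
    have "((\<lambda>y. a + b * (1 / y) + c * (1 / y\<^sup>2) + d * (ln y / y\<^sup>2)) \<longlongrightarrow> a + b * 0 + c * 0 + d * 0) at_top"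
      by (intro tendsto_intros; real_asymp)
    moreover have "\<forall>\<^sub>F y in at_top. a + b * (1 / y) + c * (1 / y\<^sup>2) + d * (ln y / y\<^sup>2) =
        (a * y\<^sup>2 + b * y + c + d * ln y) / y\<^sup>2"
      using eventually_gt_at_top[of 0] by eventually_elim (simp add: field_simps power2_eq_square)
    ultimately have "((\<lambda>y. (a * y\<^sup>2 + b * y + c + d * ln y) / y\<^sup>2) \<longlongrightarrow> a + b * 0 + c * 0 + d * 0) at_top"
      by (rule Lim_transform_eventually)
    then show "((\<lambda>y. (a * y\<^sup>2 + b * y + c + d * ln y) / y\<^sup>2) \<longlongrightarrow> a) at_top" by simp
  qed
  show b: "b = 0"
  proof (rule bounded_over_at_top_limit_eq_0[OF bounded])
    show "filterlim (\<lambda>y :: real. y) at_top at_top" by real_asymp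
    have "((\<lambda>y. b + c * (1 / y) + d * (ln y / y)) \<longlongrightarrow> b + c * 0 + d * 0) at_top"
      by (intro tendsto_intros; real_asymp)
    moreover have "\<forall>\<^sub>F y in at_top. b + c * (1 / y) + d * (ln y / y) = (a * y\<^sup>2 + b * y + c + d * ln y) / y"
      using eventually_gt_at_top[of 0] by eventually_elim (simp add: field_simps a)
    ultimately have "((\<lambda>y. (a * y\<^sup>2 + b * y + c + d * ln y) / y) \<longlongrightarrow> b + c * 0 + d * 0) at_top"
      by (rule Lim_transform_eventually)
    then show "((\<lambda>y. (a * y\<^sup>2 + b * y + c + d * ln y) / y) \<longlongrightarrow> b) at_top" by simp
  qed
  show "d = 0"
  proof (rule bounded_over_at_top_limit_eq_0[OF bounded])
    show "filterlim (ln :: real \<Rightarrow> real) at_top at_top" by real_asymp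
    have "((\<lambda>y :: real. c * (1 / ln y) + d) \<longlongrightarrow> c * 0 + d) at_top"
      by (intro tendsto_intros; real_asymp)
    moreover have "\<forall>\<^sub>F y in at_top. c * (1 / ln y) + d = (a * y\<^sup>2 + b * y + c + d * ln y) / ln y"
      using eventually_gt_at_top[of 1] by eventually_elim (simp add: field_simps a b)
    ultimately have "((\<lambda>y. (a * y\<^sup>2 + b * y + c + d * ln y) / ln y) \<longlongrightarrow> c * 0 + d) at_top"
      by (rule Lim_transform_eventually)
    then show "((\<lambda>y. (a * y\<^sup>2 + b * y + c + d * ln y) / ln y) \<longlongrightarrow> d) at_top" by simp
  qed
qed

section \<open>Logarithms of continuous densities\<close>

lemma density_lborel_eq_imp_eq:
  fixes f g :: "real \<Rightarrow> real"
  assumes f: "continuous_on UNIV f" and g: "continuous_on UNIV g"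
    and nonneg: "\<And>x. 0 \<le> f x" "\<And>x. 0 \<le> g x"
    and eq: "density lborel f = density lborel g"
  shows "f x = g x"
proof -
  have [measurable]: "f \<in> borel_measurable borel" "g \<in> borel_measurable borel"
    using f g by (auto intro: borel_measurable_continuous_onI)
  have "AE x in lborel. ennreal (f x) = ennreal (g x)"
    by (rule sigma_finite_measure.density_unique[OF sigma_finite_lborel _ _ eq]) auto
  then have "AE x in lborel. f x = g x" by (simp add: nonneg)
  then have "{x. f x \<noteq> g x} \<in> null_sets lborel"
    by (subst (asm) AE_iff_null) auto
  then have "negligible {x. f x \<noteq> g x}"
    by (simp add: negligible_iff_null_sets null_sets_completionI)
  \<comment> \<open>A negligible open set is empty, so continuity upgrades equality almost
    everywhere to equality everywhere.\<close>
  moreover have "open {x. f x \<noteq> g x}" by (rule open_Collect_neq[OF f g])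
  ultimately show ?thesis using open_not_negligible by blast
qed

lemma ln_normal_density:
  assumes "0 < \<sigma>"
  shows "ln (normal_density \<mu> \<sigma> y) =
    - (1 / (2 * \<sigma>\<^sup>2)) * y\<^sup>2 + \<mu> / \<sigma>\<^sup>2 * y + (ln (1 / sqrt (2 * pi * \<sigma>\<^sup>2)) - \<mu>\<^sup>2 / (2 * \<sigma>\<^sup>2))"
proof -
  have "ln (normal_density \<mu> \<sigma> y) = ln (1 / sqrt (2 * pi * \<sigma>\<^sup>2)) - (y - \<mu>)\<^sup>2 / (2 * \<sigma>\<^sup>2)"
    unfolding normal_density_def using assms by (subst ln_mult) auto
  also have "(y - \<mu>)\<^sup>2 / (2 * \<sigma>\<^sup>2) = 1 / (2 * \<sigma>\<^sup>2) * y\<^sup>2 - \<mu> / \<sigma>\<^sup>2 * y + \<mu>\<^sup>2 / (2 * \<sigma>\<^sup>2)"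
    using assms by (simp add: power2_diff field_simps)
  finally show ?thesis by simp
qed

text \<open>The common step of the Marshall-Olkin and order statistics cases: the law is normal, and
  two normal log-densities differ by a quadratic polynomial.\<close>

lemma infinitely_divisible_ln_density_quadratic:
  assumes cont: "continuous_on UNIV f" and pos: "\<And>y. 0 < f y"
    and le: "\<And>y. f y \<le> C * std_normal_density y"
    and idiv: "infinitely_divisible (density lborel f)"
  obtains a b c where "\<And>y. ln (f y) = ln (std_normal_density y) + a * y\<^sup>2 + b * y + c"
proof -
  have f: "f \<in> borel_measurable borel" using cont by (rule borel_measurable_continuous_onI)
  obtain \<mu> \<sigma> where \<sigma>: "0 < \<sigma>" and eq: "density lborel f = density lborel (normal_density \<mu> \<sigma>)"
    using infinitely_divisible_density_normal[OF f le idiv] by blast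
  have "f y = normal_density \<mu> \<sigma> y" for y
    by (rule density_lborel_eq_imp_eq[OF cont _ _ _ eq])
      (use \<sigma> in \<open>auto simp: less_imp_le[OF pos] continuous_on_normal_density\<close>)
  then have "ln (f y) = ln (std_normal_density y) + (1 / 2 - 1 / (2 * \<sigma>\<^sup>2)) * y\<^sup>2 + \<mu> / \<sigma>\<^sup>2 * y +
      (ln (1 / sqrt (2 * pi * \<sigma>\<^sup>2)) - \<mu>\<^sup>2 / (2 * \<sigma>\<^sup>2) - ln (1 / sqrt (2 * pi)))" for y
    using ln_normal_density[OF \<sigma>, of \<mu> y] ln_normal_density[of 1 0 y] by (simp add: algebra_simps)
  then show ?thesis by (rule that)
qed

text \<open>The denominator \<open>D\<close> is a convex combination of 1 and
  \<open>\<gamma>\<close>, so it is bounded away from 0 and \<infinity>, and so is the ratio to the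
  normal density. For \<open>\<gamma> = 1\<close> the transformation returns the normal law.\<close>

lemma not_infinitely_divisible_marshall_olkin:
  fixes \<gamma> :: real
  assumes \<gamma>: "0 < \<gamma>" "\<gamma> \<noteq> 1"
  shows "\<not> infinitely_divisible (density lborel (marshall_olkin_density \<gamma>))"
proof
  assume idiv: "infinitely_divisible (density lborel (marshall_olkin_density \<gamma>))"
  define D where "D = (\<lambda>y. std_normal_cdf y + \<gamma> * (1 - std_normal_cdf y))"
  let ?m = "min 1 \<gamma>" and ?M = "max 1 \<gamma>"
  have D_ge: "?m \<le> D y" for y
  proof -
    have "?m * std_normal_cdf y + ?m * (1 - std_normal_cdf y) \<le> 1 * std_normal_cdf y + \<gamma> * (1 - std_normal_cdf y)"
      using std_normal_cdf_pos[of y] std_normal_cdf_less_1[of y] by (intro add_mono mult_right_mono) auto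
    then show ?thesis by (simp add: D_def algebra_simps)
  qed
  have D_le: "D y \<le> ?M" for y
  proof -
    have "1 * std_normal_cdf y + \<gamma> * (1 - std_normal_cdf y) \<le> ?M * std_normal_cdf y + ?M * (1 - std_normal_cdf y)"
      using std_normal_cdf_pos[of y] std_normal_cdf_less_1[of y] by (intro add_mono mult_right_mono) auto
    then show ?thesis by (simp add: D_def algebra_simps)
  qed
  have m: "0 < ?m" using \<gamma> by simp
  have D_pos: "0 < D y" for y using D_ge[of y] m by linarith
  have s: "marshall_olkin_density \<gamma> = (\<lambda>y. \<gamma> * std_normal_density y / (D y)\<^sup>2)"
    by (simp add: marshall_olkin_density_def D_def fun_eq_iff)
  obtain a b c where q: "\<And>y. ln (marshall_olkin_density \<gamma> y) = ln (std_normal_density y) + a * y\<^sup>2 + b * y + c"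
  proof (rule infinitely_divisible_ln_density_quadratic[OF _ _ _ idiv])
    show "continuous_on UNIV (marshall_olkin_density \<gamma>)"
    proof -
      have "D y \<noteq> 0" for y using D_pos[of y] by simp
      then show ?thesis unfolding s unfolding D_def
        by (intro continuous_intros continuous_on_std_normal_density continuous_on_std_normal_cdf) auto
    qed
    show "0 < marshall_olkin_density \<gamma> y" for y
      using \<gamma> D_pos[of y] std_normal_density_pos[of y] by (simp add: s)
    show "marshall_olkin_density \<gamma> y \<le> \<gamma> / ?m\<^sup>2 * std_normal_density y" for y
    proof -
      have "\<gamma> * std_normal_density y / (D y)\<^sup>2 \<le> \<gamma> * std_normal_density y / ?m\<^sup>2"
        using \<gamma> m D_ge[of y] by (intro divide_left_mono power_mono mult_pos_pos zero_less_power D_pos) auto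
      then show ?thesis by (simp add: s)
    qed
  qed blast
  have ln_D: "a * y\<^sup>2 + b * y + c = ln \<gamma> - 2 * ln (D y)" for y
  proof -
    have "ln (marshall_olkin_density \<gamma> y) = ln \<gamma> + ln (std_normal_density y) - 2 * ln (D y)"
      using \<gamma> D_pos[of y] std_normal_density_pos[of y] by (simp add: s ln_div ln_mult ln_realpow)
    with q[of y] show ?thesis by simp
  qed
  have abs_le: "\<bar>l - 2 * x\<bar> \<le> \<bar>l\<bar> + 2 * (\<bar>u\<bar> + \<bar>v\<bar>)" if "u \<le> x" "x \<le> v" for l u v x :: real
  proof -
    have "\<bar>l - 2 * x\<bar> \<le> \<bar>l\<bar> + 2 * \<bar>x\<bar>" by linarith
    also have "\<bar>x\<bar> \<le> \<bar>u\<bar> + \<bar>v\<bar>" using that by linarith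
    finally show ?thesis by simp
  qed
  have "\<forall>\<^sub>F y in at_top. \<bar>a * y\<^sup>2 + b * y + c + 0 * ln y\<bar> \<le> \<bar>ln \<gamma>\<bar> + 2 * (\<bar>ln ?m\<bar> + \<bar>ln ?M\<bar>)"
  proof (intro always_eventually allI)
    fix y
    have "ln ?m \<le> ln (D y)" "ln (D y) \<le> ln ?M"
      using D_pos[of y] D_ge[of y] D_le[of y] m by auto
    then show "\<bar>a * y\<^sup>2 + b * y + c + 0 * ln y\<bar> \<le> \<bar>ln \<gamma>\<bar> + 2 * (\<bar>ln ?m\<bar> + \<bar>ln ?M\<bar>)"
      unfolding ln_D mult_zero_left add_0_right by (rule abs_le)
  qed
  then have "a = 0" "b = 0" by (rule bounded_quadratic_plus_ln)+
  \<comment> \<open>The polynomial is now constant, and so is \<open>D\<close>. But \<open>D\<close>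
    is affine in the strictly increasing distribution function with slope
    \<open>1 - \<gamma>\<close>.\<close>
  then have "ln (D 0) = ln (D 1)" using ln_D[of 0] ln_D[of 1] by simp
  then have "D 0 = D 1" using D_pos by simp
  then have "(1 - \<gamma>) * (std_normal_cdf 1 - std_normal_cdf 0) = 0"
    by (simp add: D_def algebra_simps)
  with \<gamma> std_normal_cdf_strict_mono[of 0 1] show False by simp
qed

text \<open>Only the right tail is examined: there \<open>std_normal_cdf\<close> stays bounded away
  from 0, and the power of \<open>1 - std_normal_cdf\<close> contributes the logarithm that no
  quadratic polynomial can absorb.\<close>

lemma not_infinitely_divisible_order_statistics:
  fixes \<psi>\<^sub>1 \<psi>\<^sub>2 :: real
  assumes \<psi>: "1 < \<psi>\<^sub>1" "1 < \<psi>\<^sub>2"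
  shows "\<not> infinitely_divisible (density lborel (order_statistics_density \<psi>\<^sub>1 \<psi>\<^sub>2))"
proof
  let ?s = "order_statistics_density \<psi>\<^sub>1 \<psi>\<^sub>2"
  assume idiv: "infinitely_divisible (density lborel ?s)"
  define K where "K = inverse (Beta \<psi>\<^sub>1 \<psi>\<^sub>2)"
  have K: "0 < K" unfolding K_def Beta_def using \<psi> by simp
  have s: "?s = (\<lambda>y. K * std_normal_density y * std_normal_cdf y powr (\<psi>\<^sub>1 - 1) * (1 - std_normal_cdf y) powr (\<psi>\<^sub>2 - 1))"
    by (simp add: order_statistics_density_def K_def fun_eq_iff)
  note cdf = std_normal_cdf_pos std_normal_cdf_less_1
  obtain a b c where q: "\<And>y. ln (?s y) = ln (std_normal_density y) + a * y\<^sup>2 + b * y + c"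
  proof (rule infinitely_divisible_ln_density_quadratic[OF _ _ _ idiv])
    show "continuous_on UNIV ?s"
    proof -
      have "std_normal_cdf y \<noteq> 0" "1 - std_normal_cdf y \<noteq> 0" for y using cdf[of y] by simp_all
      then show ?thesis unfolding s
        by (intro continuous_intros continuous_on_std_normal_density continuous_on_std_normal_cdf) auto
    qed
    show "0 < ?s y" for y
      using K cdf[of y] std_normal_density_pos[of y] by (simp add: s)
    \<comment> \<open>Both powers are at most 1 because the exponents are positive.\<close>
    show "?s y \<le> K * std_normal_density y" for y
    proof -
      have "std_normal_cdf y powr (\<psi>\<^sub>1 - 1) * (1 - std_normal_cdf y) powr (\<psi>\<^sub>2 - 1) \<le> 1 powr (\<psi>\<^sub>1 - 1) * 1 powr (\<psi>\<^sub>2 - 1)"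
        using cdf[of y] \<psi> by (intro mult_mono powr_mono2) auto
      from mult_left_mono[OF this, of "K * std_normal_density y"] K
      show ?thesis by (simp add: s mult.assoc)
    qed
  qed blast
  define d e where "d = \<psi>\<^sub>1 - 1" and "e = \<psi>\<^sub>2 - 1"
  have de: "0 < d" "0 < e" using \<psi> by (auto simp: d_def e_def)
  let ?k = "ln (1 / sqrt (2 * pi))"
  have ln_tail: "a * y\<^sup>2 + b * y + c = ln K + d * ln (std_normal_cdf y) + e * ln (1 - std_normal_cdf y)" for y
  proof -
    have "ln (?s y) = ln K + ln (std_normal_density y) + d * ln (std_normal_cdf y) + e * ln (1 - std_normal_cdf y)"
      using K cdf[of y] std_normal_density_pos[of y] by (simp add: s d_def e_def ln_mult)
    with q[of y] show ?thesis by simp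
  qed
  have "\<forall>\<^sub>F y in at_top. \<bar>(a + e / 2) * y\<^sup>2 + b * y + (c - e * ?k) + e * ln y\<bar>
      \<le> \<bar>ln K\<bar> + d * \<bar>ln (std_normal_cdf 0)\<bar> + e * ln 2"
    using eventually_gt_at_top[of 1]
  proof eventually_elim
    case (elim y)
    let ?t = "ln (1 - std_normal_cdf y)"
    have ln_phi: "ln (std_normal_density y / y) = ?k - y\<^sup>2 / 2 - ln y"
      using elim std_normal_density_pos[of y] ln_normal_density[of 1 0 y] by (simp add: ln_div)
    have "?t \<le> ln (std_normal_density y / y)"
      using std_normal_tail_upper[of y] elim cdf[of y] by simp
    moreover have "ln (std_normal_density y / y) \<le> ln (2 * (1 - std_normal_cdf y))"
      using std_normal_tail_lower[of y] elim cdf[of y] std_normal_density_pos[of y] by simp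
    moreover have ln_tail2: "ln (2 * (1 - std_normal_cdf y)) = ln 2 + ?t"
      using cdf[of y] by (intro ln_mult_pos) auto
    \<comment> \<open>The two tail bounds place the logarithm of the tail between that of
      \<open>std_normal_density y / y\<close> minus \<open>ln 2\<close> and that value
      itself.\<close>
    ultimately have "\<bar>?t - (?k - y\<^sup>2 / 2 - ln y)\<bar> \<le> ln 2"
      unfolding ln_phi ln_tail2 by (simp add: abs_le_iff)
    then have "\<bar>e * (?t - (?k - y\<^sup>2 / 2 - ln y))\<bar> \<le> e * ln 2"
      using de by (simp add: abs_mult)
    moreover have "\<bar>d * ln (std_normal_cdf y)\<bar> \<le> d * \<bar>ln (std_normal_cdf 0)\<bar>"
    proof -
      have "ln (std_normal_cdf 0) \<le> ln (std_normal_cdf y)" "ln (std_normal_cdf y) \<le> 0"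
        using cdf[of 0] cdf[of y] std_normal_cdf_strict_mono[of 0 y] elim by auto
      then show ?thesis using de by (simp add: abs_mult)
    qed
    \<comment> \<open>Moving the explicit part of the tail logarithm to the left leaves on the right
      a constant and two terms already bounded.\<close>
    moreover have "(a + e / 2) * y\<^sup>2 + b * y + (c - e * ?k) + e * ln y =
        ln K + d * ln (std_normal_cdf y) + e * (?t - (?k - y\<^sup>2 / 2 - ln y))"
      using ln_tail[of y] by (simp add: algebra_simps)
    ultimately show ?case by linarith
  qed
  then have "e = 0" by (rule bounded_quadratic_plus_ln)
  with de show False by simp
qed

theorem corollary1:
  shows "(\<forall>\<pi> :: real \<Rightarrow> real.
            \<pi> \<in> borel_measurable borel
            \<longrightarrow> (\<forall>y. 0 \<le> \<pi> y \<and> \<pi> y \<le> 1)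
            \<longrightarrow> (\<forall>y. \<pi> (- y) = 1 - \<pi> y)
            \<longrightarrow> \<not> (AE y in lborel. \<pi> y = 1 / 2)
            \<longrightarrow> \<not> infinitely_divisible (density lborel (skew_symmetric_density \<pi>)))
       \<and> (\<forall>\<gamma> :: real.
            \<gamma> > 0 \<longrightarrow> \<gamma> \<noteq> 1
            \<longrightarrow> \<not> infinitely_divisible (density lborel (marshall_olkin_density \<gamma>)))
       \<and> (\<forall>\<psi>\<^sub>1 \<psi>\<^sub>2 :: real.
            \<psi>\<^sub>1 > 1 \<longrightarrow> \<psi>\<^sub>2 > 1
            \<longrightarrow> \<not> infinitely_divisible (density lborel (order_statistics_density \<psi>\<^sub>1 \<psi>\<^sub>2)))"
  using not_infinitely_divisible_skew_symmetric not_infinitely_divisible_marshall_olkin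
    not_infinitely_divisible_order_statistics by blast

end
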